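(* Let $y_1,\dots,y_n\in[0,\infty)$ be a sample with $s_n^2:=\frac1n\sum_{i=1}^n(y_i-\bar y)^2>0$, where $\bar y=\frac1n\sum_{i=1}^n y_i$, and let $\ell_n(\mu,\sigma)=\sum_{i=1}^n\log f(y_i;\mu,\sigma)$ be the folded normal log-likelihood. Then $\ell_n$ attains its global maximum over $\Theta=\mathbb{R}\times(0,\infty)$. Moreover, any maximizer has the form $(\pm\hat\mu(\hat\sigma),\hat\sigma)$, where: (i) for each $\sigma>0$, $\hat\mu(\sigma)$ is the unique maximizer of $\mu\mapsto\ell_n(\mu,\sigma)$ on $[0,\infty)$; and (ii) $\hat\sigma$ is a maximizer over $\sigma\in(0,\infty)$ of the profile $\sigma\mapsto\ell_n(\hat\mu(\sigma),\sigma)$.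
   Context: The folded normal density with parameters $\mu\in\mathbb{R}$, $\sigma>0$ is $$f(y;\mu,\sigma)=\frac1\sigma\Big\{\varphi\Big(\frac{y-\mu}{\sigma}\Big)+\varphi\Big(\frac{y+\mu}{\sigma}\Big)\Big\}=\frac{2}{\sigma\sqrt{2\pi}}\exp\Big(-\frac{y^2+\mu^2}{2\sigma^2}\Big)\cosh\Big(\frac{y\mu}{\sigma^2}\Big),\quad y\ge0,$$ where $\varphi(z)=(2\pi)^{-1/2}e^{-z^2/2}$. For a sample with $s_n^2>0$ and each $\sigma>0$, the function $\mu\mapsto\ell_n(\mu,\sigma)$ has a unique maximizer on $[0,\infty)$ (so $\hat\mu(\sigma)$ is well defined). *)

theory Defs
  imports "HOL-Probability.Distributions"
begin

text \<open>
  The density formula below is only meaningful for \<open>\<sigma> > 0\<close> and \<open>y \<ge> 0\<close>. It is not truncated to \<open>0\<close>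
  for negative \<open>y\<close>, so statements about samples must assume nonnegative observations.
\<close>

definition folded_normal_density :: "real \<Rightarrow> real \<Rightarrow> real \<Rightarrow> real" where
  "folded_normal_density \<mu> \<sigma> y =
     1 / \<sigma> * (std_normal_density ((y - \<mu>) / \<sigma>) + std_normal_density ((y + \<mu>) / \<sigma>))"

lemma folded_normal_density_cosh:
  assumes "\<sigma> > 0"
  shows "folded_normal_density \<mu> \<sigma> y =
           2 / (\<sigma> * sqrt (2 * pi)) * exp (- (y\<^sup>2 + \<mu>\<^sup>2) / (2 * \<sigma>\<^sup>2)) * cosh (y * \<mu> / \<sigma>\<^sup>2)"
proof -
  define E z where "E = exp (- (y\<^sup>2 + \<mu>\<^sup>2) / (2 * \<sigma>\<^sup>2))" and "z = y * \<mu> / \<sigma>\<^sup>2"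
  have "- (((y - \<mu>) / \<sigma>)\<^sup>2) / 2 = - (y\<^sup>2 + \<mu>\<^sup>2) / (2 * \<sigma>\<^sup>2) + z"
    and "- (((y + \<mu>) / \<sigma>)\<^sup>2) / 2 = - (y\<^sup>2 + \<mu>\<^sup>2) / (2 * \<sigma>\<^sup>2) + - z"
    using assms by (auto simp: z_def field_simps power2_eq_square)
  then have "std_normal_density ((y - \<mu>) / \<sigma>) = 1 / sqrt (2 * pi) * (E * exp z)"
    and "std_normal_density ((y + \<mu>) / \<sigma>) = 1 / sqrt (2 * pi) * (E * exp (- z))"
    unfolding std_normal_density_def E_def by (simp_all only: exp_add)
  then have "folded_normal_density \<mu> \<sigma> y = 2 / (\<sigma> * sqrt (2 * pi)) * E * cosh z"
    unfolding folded_normal_density_def cosh_def using assms by (simp add: field_simps)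
  then show ?thesis by (simp add: E_def z_def)
qed

text \<open>A sample of size \<open>n\<close> is a function \<open>y\<close> of which only the values \<open>y 1, \<dots>, y n\<close> are used.\<close>

definition sample_mean :: "nat \<Rightarrow> (nat \<Rightarrow> real) \<Rightarrow> real" where
  "sample_mean n y = 1 / real n * (\<Sum>i=1..n. y i)"

definition sample_variance :: "nat \<Rightarrow> (nat \<Rightarrow> real) \<Rightarrow> real" where
  "sample_variance n y = 1 / real n * (\<Sum>i=1..n. (y i - sample_mean n y)\<^sup>2)"

definition folded_normal_loglik :: "nat \<Rightarrow> (nat \<Rightarrow> real) \<Rightarrow> real \<Rightarrow> real \<Rightarrow> real" where
  "folded_normal_loglik n y \<mu> \<sigma> = (\<Sum>i=1..n. ln (folded_normal_density \<mu> \<sigma> (y i)))"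

text \<open>The value of \<open>mu_hat\<close> is specified only where the maximizer over \<open>[0, \<infinity>)\<close> exists and is unique.\<close>

definition mu_hat :: "nat \<Rightarrow> (nat \<Rightarrow> real) \<Rightarrow> real \<Rightarrow> real" where
  "mu_hat n y \<sigma> = (THE \<mu>. is_arg_max (\<lambda>\<mu>. folded_normal_loglik n y \<mu> \<sigma>) (\<lambda>\<mu>. \<mu> \<in> {0..}) \<mu>)"

definition profile_loglik :: "nat \<Rightarrow> (nat \<Rightarrow> real) \<Rightarrow> real \<Rightarrow> real" where
  "profile_loglik n y \<sigma> = folded_normal_loglik n y (mu_hat n y \<sigma>) \<sigma>"

definition param_space :: "(real \<times> real) set" where
  "param_space = UNIV \<times> {0<..}"

end

theory Submission
  imports Defs "HOL-Real_Asymp.Real_Asymp"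
begin

text \<open>
  Since \<open>ln (cosh x) \<le> \<bar>x\<bar>\<close>, the folded normal log-likelihood at \<open>(\<mu>, \<sigma>)\<close> is bounded by an ordinary
  normal log-likelihood at \<open>(\<bar>\<mu>\<bar>, \<sigma>)\<close>. As the sample variance is positive, the latter tends to
  \<open>-\<infinity>\<close> at the boundary of the parameter space, so superlevel sets are relatively compact and
  maxima exist. For fixed \<open>\<sigma>\<close> the score, divided by \<open>\<mu>\<close>, is strictly decreasing on \<open>(0, \<infinity>)\<close> because
  \<open>tanh x / x\<close> is; so the log-likelihood strictly increases up to any positive critical point, which
  leaves room for only one maximizer. The rest follows from the evenness in \<open>\<mu>\<close>.
\<close>

text \<open>The superlevel set of \<open>z\<close> lies in \<open>K\<close>, and \<open>z\<close>
  with it. Points of \<open>S\<close> outside \<open>K\<close> stay below \<open>f z\<close>, so a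
  maximum over \<open>K\<close> is one over \<open>S\<close>.\<close>

lemma is_arg_max_exists_compact_superlevel:
  fixes f :: "'a::topological_space \<Rightarrow> real"
  assumes "compact K" "K \<subseteq> S" "continuous_on K f" "z \<in> S"
    and "\<And>x. x \<in> S \<Longrightarrow> f z \<le> f x \<Longrightarrow> x \<in> K"
  shows "\<exists>x. is_arg_max f (\<lambda>x. x \<in> S) x"
proof -
  have z: "z \<in> K" using assms(4,5) by auto
  obtain x where x: "x \<in> K" "\<forall>w\<in>K. f w \<le> f x"
    using continuous_attains_sup[OF assms(1) _ assms(3)] z by blast
  have "f w \<le> f x" if "w \<in> S" for w
    using x z assms(5)[OF that] by (cases "f z \<le> f w") force+
  then show ?thesis using x(1) assms(2) by (auto simp: is_arg_max_linorder)
qed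

section \<open>Inequalities for hyperbolic functions\<close>

lemma sinh_gt_self:
  fixes x :: real
  assumes "x > 0"
  shows "x < sinh x"
proof -
  have "sinh 0 - 0 < sinh x - x"
  \<comment> \<open>The derivative \<open>cosh t - 1\<close> vanishes at 0, hence the version that
    asks for positivity on the open interval only.\<close>
  proof (rule DERIV_pos_imp_increasing_open[OF assms])
    fix t :: real assume "0 < t" "t < x"
    then have "cosh t > 1"
      using cosh_real_nonneg_less_iff[of 0 t] by simp
    then show "\<exists>d. ((\<lambda>t. sinh t - t) has_real_derivative d) (at t) \<and> 0 < d"
      by (intro exI[of _ "cosh t - 1"]) (auto intro!: derivative_eq_intros)
  qed (intro continuous_intros)
  then show ?thesis by simp
qed

text \<open>Up to the positive factor \<open>(x * cosh x)\<^sup>2\<close>, the derivative is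
  \<open>x - sinh x * cosh x\<close>, which is negative since \<open>sinh x > x\<close> and
  \<open>cosh x \<ge> 1\<close>.\<close>

lemma tanh_over_self_strict_antimono:
  fixes s u :: real
  assumes "0 < s" "s < u"
  shows "tanh u / u < tanh s / s"
proof (rule DERIV_neg_imp_decreasing[OF assms(2)])
  fix x assume "s \<le> x" "x \<le> u"
  with assms have x: "x > 0" by simp
  have c: "cosh x \<ge> 1" by (rule cosh_real_ge_1)
  have "x < sinh x * cosh x"
    using sinh_gt_self[OF x] x mult_left_mono[OF c, of "sinh x"] by linarith
  moreover have "1 - (tanh x)\<^sup>2 = 1 / (cosh x)\<^sup>2"
    using hyperbolic_pythagoras[of x] c by (simp add: tanh_def power_divide divide_simps)
  ultimately have "(1 - (tanh x)\<^sup>2) * x < tanh x"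
    using c by (simp add: tanh_def divide_simps power2_eq_square mult.commute)
  then have "((1 - (tanh x)\<^sup>2) * x - tanh x) / (x * x) < 0"
    using x by (intro divide_neg_pos) auto
  moreover have "((\<lambda>x. tanh x / x) has_real_derivative ((1 - (tanh x)\<^sup>2) * x - tanh x) / (x * x)) (at x)"
    using x by (auto intro!: derivative_eq_intros)
  ultimately show "\<exists>d. ((\<lambda>x. tanh x / x) has_real_derivative d) (at x) \<and> d < 0" by blast
qed

lemma ln_cosh_le_abs: "ln (cosh x) \<le> \<bar>x :: real\<bar>"
proof -
  have "cosh x \<le> exp \<bar>x\<bar>" by (auto simp: cosh_def abs_if)
  then show ?thesis by (simp add: ln_le_cancel_iff[symmetric] del: ln_le_cancel_iff)
qed

section \<open>Closed form, symmetry, continuity and score of the log-likelihood\<close>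

lemma folded_normal_loglik_altdef:
  assumes "\<sigma> > 0"
  shows "folded_normal_loglik n y \<mu> \<sigma> = (\<Sum>i=1..n. ln (2 / sqrt (2 * pi)) - ln \<sigma>
    - ((y i)\<^sup>2 + \<mu>\<^sup>2) / (2 * \<sigma>\<^sup>2) + ln (cosh (y i * \<mu> / \<sigma>\<^sup>2)))"
proof -
  have "ln (folded_normal_density \<mu> \<sigma> t) = ln (2 / sqrt (2 * pi)) - ln \<sigma>
    - (t\<^sup>2 + \<mu>\<^sup>2) / (2 * \<sigma>\<^sup>2) + ln (cosh (t * \<mu> / \<sigma>\<^sup>2))" for t
    unfolding folded_normal_density_cosh[OF assms] using assms
    by (simp add: ln_mult ln_div) (simp add: field_simps)
  then show ?thesis by (simp add: folded_normal_loglik_def)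
qed

text \<open>Changing the sign of \<open>\<mu>\<close> swaps the two normal densities in the folded
  one.\<close>

lemma folded_normal_loglik_abs:
  "folded_normal_loglik n y \<bar>\<mu>\<bar> \<sigma> = folded_normal_loglik n y \<mu> \<sigma>"
proof -
  have "folded_normal_density (- \<mu>) \<sigma> t = folded_normal_density \<mu> \<sigma> t" for \<mu> t
    by (simp add: folded_normal_density_def)
  then show ?thesis by (simp add: folded_normal_loglik_def abs_if)
qed

text \<open>The composite form covers both joint continuity and continuity in \<open>\<mu>\<close>
  alone.\<close>

lemma continuous_on_folded_normal_loglik [continuous_intros]:
  assumes "continuous_on A f" "continuous_on A g" "\<And>x. x \<in> A \<Longrightarrow> g x > 0"
  shows "continuous_on A (\<lambda>x. folded_normal_loglik n y (f x) (g x))"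
proof -
  have "g x \<noteq> 0" if "x \<in> A" for x using assms(3)[OF that] by simp
  then have "continuous_on A (\<lambda>x. \<Sum>i=1..n. ln (2 / sqrt (2 * pi)) - ln (g x)
    - ((y i)\<^sup>2 + (f x)\<^sup>2) / (2 * (g x)\<^sup>2) + ln (cosh (y i * f x / (g x)\<^sup>2)))"
    by (intro continuous_intros assms) auto
  then show ?thesis
    by (rule continuous_on_eq) (simp add: folded_normal_loglik_altdef assms(3))
qed

lemma folded_normal_loglik_has_derivative:
  assumes "\<sigma> > 0"
  shows "((\<lambda>\<mu>. folded_normal_loglik n y \<mu> \<sigma>) has_real_derivative
    (\<Sum>i=1..n. y i / \<sigma>\<^sup>2 * tanh (y i * \<mu> / \<sigma>\<^sup>2) - \<mu> / \<sigma>\<^sup>2)) (at \<mu>)"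
  unfolding folded_normal_loglik_altdef[OF assms] using assms
  by (auto intro!: derivative_eq_intros sum.cong simp: tanh_def field_simps eval_nat_numeral)

section \<open>Comparison with the normal log-likelihood and bounds on superlevel sets\<close>

lemma sum_square_deviation:
  "(\<Sum>i=1..n. (y i - m)\<^sup>2) = n * (sample_variance n y + (m - sample_mean n y)\<^sup>2)"
proof (cases "n = 0")
  case False
  define a where "a = sample_mean n y"
  have s: "(\<Sum>i=1..n. y i) = n * a" using False by (simp add: a_def sample_mean_def)
  have v: "n * sample_variance n y = (\<Sum>i=1..n. (y i - a)\<^sup>2)"
    using False by (simp add: a_def sample_variance_def)
  \<comment> \<open>The difference of the two squares is affine in \<open>y i\<close>, so its sum
    depends on the sample only through the mean.\<close>
  have "(\<Sum>i=1..n. (y i - m)\<^sup>2) = (\<Sum>i=1..n. (y i - a)\<^sup>2 + (2 * (a - m)) * y i + (m\<^sup>2 - a\<^sup>2))"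
    by (intro sum.cong) (auto simp: power2_eq_square algebra_simps)
  also have "\<dots> = n * sample_variance n y + 2 * (a - m) * (n * a) + n * (m\<^sup>2 - a\<^sup>2)"
    by (simp add: sum.distrib v s sum_distrib_left[symmetric] del: One_nat_def)
  also have "\<dots> = n * (sample_variance n y + (m - a)\<^sup>2)"
    by (simp add: power2_eq_square algebra_simps)
  finally show ?thesis by (simp add: a_def)
qed simp

text \<open>The right-hand side is the normal log-likelihood at
  \<open>(\<bar>\<mu>\<bar>, \<sigma>)\<close> plus \<open>n * ln 2\<close>. Bounding
  \<open>ln (cosh x)\<close> by \<open>\<bar>x\<bar>\<close> supplies the cross term that completes
  each square.\<close>

lemma folded_normal_loglik_le:
  assumes "\<And>i. i \<in> {1..n} \<Longrightarrow> y i \<ge> 0" "\<sigma> > 0"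
  shows "folded_normal_loglik n y \<mu> \<sigma> \<le> n * (ln (2 / sqrt (2 * pi)) - ln \<sigma>
    - (sample_variance n y + (\<bar>\<mu>\<bar> - sample_mean n y)\<^sup>2) / (2 * \<sigma>\<^sup>2))"
proof -
  have "folded_normal_loglik n y \<mu> \<sigma> \<le>
    (\<Sum>i=1..n. ln (2 / sqrt (2 * pi)) - ln \<sigma> - (y i - \<bar>\<mu>\<bar>)\<^sup>2 / (2 * \<sigma>\<^sup>2))"
    unfolding folded_normal_loglik_altdef[OF assms(2)]
  proof (rule sum_mono)
    fix i assume "i \<in> {1..n}"
    then have "ln (cosh (y i * \<mu> / \<sigma>\<^sup>2)) \<le> y i * \<bar>\<mu>\<bar> / \<sigma>\<^sup>2"
      using assms(1) ln_cosh_le_abs[of "y i * \<mu> / \<sigma>\<^sup>2"] by (simp add: abs_mult)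
    moreover have sq: "(y i - \<bar>\<mu>\<bar>)\<^sup>2 / (2 * \<sigma>\<^sup>2) = ((y i)\<^sup>2 + \<mu>\<^sup>2) / (2 * \<sigma>\<^sup>2) - y i * \<bar>\<mu>\<bar> / \<sigma>\<^sup>2"
      using assms(2) by (simp add: power2_diff field_simps)
    ultimately show "ln (2 / sqrt (2 * pi)) - ln \<sigma> - ((y i)\<^sup>2 + \<mu>\<^sup>2) / (2 * \<sigma>\<^sup>2)
        + ln (cosh (y i * \<mu> / \<sigma>\<^sup>2))
      \<le> ln (2 / sqrt (2 * pi)) - ln \<sigma> - (y i - \<bar>\<mu>\<bar>)\<^sup>2 / (2 * \<sigma>\<^sup>2)"
      unfolding sq by simp
  qed
  also have "\<dots> = n * (ln (2 / sqrt (2 * pi)) - ln \<sigma>)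
      - n * (sample_variance n y + (\<bar>\<mu>\<bar> - sample_mean n y)\<^sup>2) / (2 * \<sigma>\<^sup>2)"
    by (simp add: sum_subtractf sum_divide_distrib[symmetric] sum_square_deviation
        del: One_nat_def)
  finally show ?thesis by (simp add: right_diff_distrib)
qed

lemma folded_normal_loglik_superlevel_compact:
  assumes "\<And>i. i \<in> {1..n} \<Longrightarrow> y i \<ge> 0" "sample_variance n y > 0"
  obtains a b M where "a > 0"
    "\<And>\<mu> \<sigma>. \<sigma> > 0 \<Longrightarrow> c \<le> folded_normal_loglik n y \<mu> \<sigma> \<Longrightarrow> \<sigma> \<in> {a..b} \<and> \<mu> \<in> {-M..M}"
proof -
  define v where "v = sample_variance n y"
  define m where "m = sample_mean n y"
  define k where "k = ln (2 / sqrt (2 * pi)) - c / n"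
  have v: "v > 0" using assms(2) by (simp add: v_def)
  \<comment> \<open>For \<open>n = 0\<close> the variance would be an empty sum, hence 0.\<close>
  have n: "n > 0" using assms(2) by (cases n) (auto simp: sample_variance_def)
  have bound: "ln \<sigma> + v / (2 * \<sigma>\<^sup>2) + (\<bar>\<mu>\<bar> - m)\<^sup>2 / (2 * \<sigma>\<^sup>2) \<le> k"
    if "\<sigma> > 0" "c \<le> folded_normal_loglik n y \<mu> \<sigma>" for \<mu> \<sigma>
  proof -
    have "c \<le> n * (ln (2 / sqrt (2 * pi)) - ln \<sigma> - (v + (\<bar>\<mu>\<bar> - m)\<^sup>2) / (2 * \<sigma>\<^sup>2))"
      unfolding v_def m_def
      using that(2) folded_normal_loglik_le[of n y \<sigma> \<mu>, OF assms(1) that(1)] by linarith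
    then have "c / n \<le> ln (2 / sqrt (2 * pi)) - ln \<sigma> - (v + (\<bar>\<mu>\<bar> - m)\<^sup>2) / (2 * \<sigma>\<^sup>2)"
      using n by (simp add: divide_le_eq mult.commute)
    then show ?thesis unfolding k_def by (simp add: add_divide_distrib)
  qed
  \<comment> \<open>Positive variance keeps \<open>\<sigma>\<close> away from 0: the term
    \<open>v / (2 * \<sigma>\<^sup>2)\<close> outgrows \<open>- ln \<sigma>\<close>.\<close>
  have "filterlim (\<lambda>\<sigma>. ln \<sigma> + v / (2 * \<sigma>\<^sup>2)) at_top (at_right 0)"
    using v by real_asymp
  then have "eventually (\<lambda>\<sigma>. ln \<sigma> + v / (2 * \<sigma>\<^sup>2) > k) (at_right 0)"
    by (simp add: filterlim_at_top_dense)
  then obtain a where a: "a > 0" "\<And>\<sigma>. 0 < \<sigma> \<Longrightarrow> \<sigma> < a \<Longrightarrow> ln \<sigma> + v / (2 * \<sigma>\<^sup>2) > k"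
    unfolding eventually_at_right_field by auto
  \<comment> \<open>Dropping the two nonnegative fractions from \<open>bound\<close> gives
    \<open>ln \<sigma> \<le> k\<close>. With \<open>a \<le> \<sigma> \<le> b\<close>, what remains
    of \<open>bound\<close> limits \<open>(\<bar>\<mu>\<bar> - m)\<^sup>2\<close> by
    \<open>D\<close>.\<close>
  define b where "b = exp k"
  define D where "D = (k - ln a) * (2 * b\<^sup>2)"
  show ?thesis
  proof (rule that[OF a(1), of b "m + sqrt D"])
    fix \<mu> \<sigma> assume *: "\<sigma> > 0" "c \<le> folded_normal_loglik n y \<mu> \<sigma>"
    note B = bound[OF this]
    have nonneg: "v / (2 * \<sigma>\<^sup>2) \<ge> 0" "(\<bar>\<mu>\<bar> - m)\<^sup>2 / (2 * \<sigma>\<^sup>2) \<ge> 0" using v by auto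
    have \<sigma>a: "a \<le> \<sigma>" using a(2)[OF *(1)] B nonneg by fastforce
    have "ln \<sigma> \<le> k" using B nonneg by linarith
    then have \<sigma>b: "\<sigma> \<le> b" using *(1) by (metis b_def exp_le_cancel_iff exp_ln)
    have "ln a \<le> ln \<sigma>" using \<sigma>a a(1) by simp
    then have q: "(\<bar>\<mu>\<bar> - m)\<^sup>2 / (2 * \<sigma>\<^sup>2) \<le> k - ln a" using B nonneg by linarith
    then have "(\<bar>\<mu>\<bar> - m)\<^sup>2 \<le> (k - ln a) * (2 * \<sigma>\<^sup>2)" using *(1) by (simp add: divide_le_eq)
    also have "\<dots> \<le> D" unfolding D_def
      \<comment> \<open>Monotonicity in \<open>\<sigma>\<close> requires
        \<open>k - ln a \<ge> 0\<close>, which holds because this number bounds a square.\<close>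
      using order_trans[OF nonneg(2) q] \<sigma>b *(1) by (intro mult_left_mono power_mono) auto
    finally have "\<bar>\<mu>\<bar> - m \<le> sqrt D" by (rule real_le_rsqrt)
    then show "\<sigma> \<in> {a..b} \<and> \<mu> \<in> {- (m + sqrt D)..m + sqrt D}"
      using \<sigma>a \<sigma>b by auto
  qed
qed

section \<open>Existence of joint maximizers and of maximizers for fixed
  \<open>\<sigma>\<close>\<close>

lemma exists_folded_normal_mle:
  assumes "\<And>i. i \<in> {1..n} \<Longrightarrow> y i \<ge> 0" "sample_variance n y > 0"
  shows "\<exists>\<theta>. is_arg_max (\<lambda>(\<mu>, \<sigma>). folded_normal_loglik n y \<mu> \<sigma>) (\<lambda>\<theta>. \<theta> \<in> param_space) \<theta>"
proof -
  obtain a b M where a: "a > 0" and sup: "\<And>\<mu> \<sigma>. \<sigma> > 0 \<Longrightarrow>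
    folded_normal_loglik n y 0 1 \<le> folded_normal_loglik n y \<mu> \<sigma> \<Longrightarrow> \<sigma> \<in> {a..b} \<and> \<mu> \<in> {-M..M}"
    using folded_normal_loglik_superlevel_compact[OF assms] by blast
  show ?thesis
  \<comment> \<open>The reference point is an arbitrary element of the parameter space.\<close>
  proof (rule is_arg_max_exists_compact_superlevel[where K = "{-M..M} \<times> {a..b}" and z = "(0, 1)"])
    show "continuous_on ({-M..M} \<times> {a..b}) (\<lambda>(\<mu>, \<sigma>). folded_normal_loglik n y \<mu> \<sigma>)"
      unfolding case_prod_unfold using a by (intro continuous_intros) auto
  qed (use a sup in \<open>auto simp: param_space_def intro!: compact_Times\<close>)
qed

lemma exists_folded_normal_mu_mle:
  assumes "\<And>i. i \<in> {1..n} \<Longrightarrow> y i \<ge> 0" "sample_variance n y > 0" "\<sigma> > 0"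
  shows "\<exists>\<mu>. is_arg_max (\<lambda>\<mu>. folded_normal_loglik n y \<mu> \<sigma>) (\<lambda>\<mu>. \<mu> \<in> {0..}) \<mu>"
proof -
  obtain a b M where sup: "\<And>\<mu> \<sigma>'. \<sigma>' > 0 \<Longrightarrow>
    folded_normal_loglik n y 0 \<sigma> \<le> folded_normal_loglik n y \<mu> \<sigma>' \<Longrightarrow> \<sigma>' \<in> {a..b} \<and> \<mu> \<in> {-M..M}"
    using folded_normal_loglik_superlevel_compact[OF assms(1,2)] by metis
  show ?thesis
  proof (rule is_arg_max_exists_compact_superlevel[where K = "{0..M}" and z = 0])
    show "continuous_on {0..M} (\<lambda>\<mu>. folded_normal_loglik n y \<mu> \<sigma>)"
      using assms(3) by (intro continuous_intros) auto
  qed (use sup[OF assms(3)] in auto)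
qed

section \<open>Uniqueness of the maximizer in \<open>\<mu>\<close> for fixed
  \<open>\<sigma>\<close>\<close>

text \<open>With \<open>g\<close> the score, \<open>g \<mu> / \<mu>\<close> is strictly decreasing
  for \<open>\<mu> > 0\<close> and vanishes at \<open>b\<close>, so \<open>g\<close> is positive on
  the open interval from \<open>a\<close> to \<open>b\<close>, even when
  \<open>a = 0\<close>.\<close>

lemma folded_normal_loglik_less_critical_point:
  assumes "\<And>i. i \<in> {1..n} \<Longrightarrow> y i \<ge> 0" "sample_variance n y > 0" "\<sigma> > 0"
    and "0 \<le> a" "a < b"
    and crit: "((\<lambda>\<mu>. folded_normal_loglik n y \<mu> \<sigma>) has_real_derivative 0) (at b)"
  shows "folded_normal_loglik n y a \<sigma> < folded_normal_loglik n y b \<sigma>"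
proof (rule DERIV_pos_imp_increasing_open[OF \<open>a < b\<close>])
  define g where "g \<mu> = (\<Sum>i=1..n. y i / \<sigma>\<^sup>2 * tanh (y i * \<mu> / \<sigma>\<^sup>2) - \<mu> / \<sigma>\<^sup>2)" for \<mu>
  have der: "((\<lambda>\<mu>. folded_normal_loglik n y \<mu> \<sigma>) has_real_derivative g \<mu>) (at \<mu>)" for \<mu>
    unfolding g_def by (rule folded_normal_loglik_has_derivative[OF \<open>\<sigma> > 0\<close>])
  have g_b: "g b = 0" using DERIV_unique[OF der crit] .
  \<comment> \<open>Zero observations contribute constant summands to
    \<open>g \<mu> / \<mu>\<close>; strictness needs one positive observation.\<close>
  obtain j where j: "j \<in> {1..n}" "y j > 0"
  proof -
    have "\<exists>j\<in>{1..n}. y j \<noteq> 0"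
    proof (rule ccontr)
      assume "\<not> ?thesis"
      then have "sample_variance n y = 0" by (simp add: sample_variance_def sample_mean_def)
      with assms(2) show False by simp
    qed
    then show ?thesis using that assms(1) by force
  qed
  fix t assume t: "a < t" "t < b"
  with \<open>0 \<le> a\<close> have t0: "0 < t" "0 < b" by auto
  have strict: "y i * tanh (y i * b / \<sigma>\<^sup>2) / b < y i * tanh (y i * t / \<sigma>\<^sup>2) / t" if "y i > 0" for i
  proof -
    \<comment> \<open>Rescaling by \<open>c\<close> reduces the claim to the monotonicity of
      \<open>tanh x / x\<close>.\<close>
    define c where "c = y i / \<sigma>\<^sup>2"
    have c: "c > 0" using that \<open>\<sigma> > 0\<close> by (simp add: c_def)
    have "tanh (c * b) / (c * b) < tanh (c * t) / (c * t)"
      using c t t0 by (intro tanh_over_self_strict_antimono) auto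
    then have "c * (tanh (c * b) / (c * b)) < c * (tanh (c * t) / (c * t))"
      using c by (rule mult_strict_left_mono)
    then have "tanh (c * b) / b < tanh (c * t) / t" using c by simp
    then have "y i * (tanh (c * b) / b) < y i * (tanh (c * t) / t)"
      using that by (rule mult_strict_left_mono)
    then show ?thesis by (simp add: c_def)
  qed
  have scaled: "g \<mu> / \<mu> = (\<Sum>i=1..n. y i * tanh (y i * \<mu> / \<sigma>\<^sup>2) / \<mu> - 1) / \<sigma>\<^sup>2" if "\<mu> > 0" for \<mu>
    unfolding g_def sum_divide_distrib using that \<open>\<sigma> > 0\<close>
    by (intro sum.cong) (auto simp: field_simps)
  have "(\<Sum>i=1..n. y i * tanh (y i * b / \<sigma>\<^sup>2) / b - 1) < (\<Sum>i=1..n. y i * tanh (y i * t / \<sigma>\<^sup>2) / t - 1)"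
  proof (rule sum_strict_mono_ex1)
    show "\<forall>i\<in>{1..n}. y i * tanh (y i * b / \<sigma>\<^sup>2) / b - 1 \<le> y i * tanh (y i * t / \<sigma>\<^sup>2) / t - 1"
    proof
      fix i assume "i \<in> {1..n}"
      with assms(1) have "y i \<ge> 0" .
      then show "y i * tanh (y i * b / \<sigma>\<^sup>2) / b - 1 \<le> y i * tanh (y i * t / \<sigma>\<^sup>2) / t - 1"
        using strict[of i] by (cases "y i = 0") auto
    qed
    show "\<exists>i\<in>{1..n}. y i * tanh (y i * b / \<sigma>\<^sup>2) / b - 1 < y i * tanh (y i * t / \<sigma>\<^sup>2) / t - 1"
      using j strict by force
  qed simp
  then have "g b / b < g t / t"
    unfolding scaled[OF t0(1)] scaled[OF t0(2)] using \<open>\<sigma> > 0\<close> by (intro divide_strict_right_mono) auto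
  then have "g t > 0" using g_b t0 by (simp add: zero_less_divide_iff)
  then show "\<exists>d. ((\<lambda>\<mu>. folded_normal_loglik n y \<mu> \<sigma>) has_real_derivative d) (at t) \<and> 0 < d"
    using der by blast
next
  show "continuous_on {a..b} (\<lambda>\<mu>. folded_normal_loglik n y \<mu> \<sigma>)"
    using \<open>\<sigma> > 0\<close> by (intro continuous_intros) auto
qed

text \<open>The larger of two maximizers would be positive, hence a critical point, and would then
  have a strictly larger value than the smaller one.\<close>

lemma ex1_folded_normal_mu_mle:
  assumes "\<And>i. i \<in> {1..n} \<Longrightarrow> y i \<ge> 0" "sample_variance n y > 0" "\<sigma> > 0"
  shows "\<exists>!\<mu>. is_arg_max (\<lambda>\<mu>. folded_normal_loglik n y \<mu> \<sigma>) (\<lambda>\<mu>. \<mu> \<in> {0..}) \<mu>"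
proof -
  let ?l = "\<lambda>\<mu>. folded_normal_loglik n y \<mu> \<sigma>"
  have no_pair: False if "is_arg_max ?l (\<lambda>\<mu>. \<mu> \<in> {0..}) a" "is_arg_max ?l (\<lambda>\<mu>. \<mu> \<in> {0..}) b" "a < b" for a b
  proof -
    have a: "0 \<le> a" and max: "\<And>\<mu>. \<mu> \<ge> 0 \<Longrightarrow> ?l \<mu> \<le> ?l a" "\<And>\<mu>. \<mu> \<ge> 0 \<Longrightarrow> ?l \<mu> \<le> ?l b"
      using that(1,2) by (auto simp: is_arg_max_linorder)
    note der = folded_normal_loglik_has_derivative[OF assms(3), of n y b]
    \<comment> \<open>Radius \<open>b\<close> keeps the neighbourhood inside the positive half-line,
      so \<open>b\<close> is an unconstrained local maximum.\<close>
    have "?l \<mu> \<le> ?l b" if "\<bar>b - \<mu>\<bar> < b" for \<mu>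
      using that by (intro max) auto
    then have "(?l has_real_derivative 0) (at b)"
      using DERIV_local_max[OF der, of b] der a \<open>a < b\<close> by auto
    with assms a \<open>a < b\<close> have "?l a < ?l b"
      by (rule folded_normal_loglik_less_critical_point)
    with max(1)[of b] a \<open>a < b\<close> show False by auto
  qed
  show ?thesis
    using exists_folded_normal_mu_mle[OF assms] no_pair by (metis linorder_neqE)
qed

theorem theorem3p9:
  fixes n :: nat and y :: "nat \<Rightarrow> real"
  assumes "\<And>i. i \<in> {1..n} \<Longrightarrow> y i \<ge> 0"
    and "sample_variance n y > 0"
  shows "(\<exists>\<theta>. is_arg_max (\<lambda>(\<mu>, \<sigma>). folded_normal_loglik n y \<mu> \<sigma>) (\<lambda>\<theta>. \<theta> \<in> param_space) \<theta>) \<and>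
    (\<forall>\<sigma>>0. \<exists>!\<mu>. is_arg_max (\<lambda>\<mu>. folded_normal_loglik n y \<mu> \<sigma>) (\<lambda>\<mu>. \<mu> \<in> {0..}) \<mu>) \<and>
    (\<forall>\<mu> \<sigma>. is_arg_max (\<lambda>(\<mu>, \<sigma>). folded_normal_loglik n y \<mu> \<sigma>) (\<lambda>\<theta>. \<theta> \<in> param_space) (\<mu>, \<sigma>) \<longrightarrow>
       (\<mu> = mu_hat n y \<sigma> \<or> \<mu> = - mu_hat n y \<sigma>) \<and>
       is_arg_max (profile_loglik n y) (\<lambda>\<sigma>. \<sigma> \<in> {0<..}) \<sigma>)"
proof (intro conjI allI impI)
  show "\<exists>\<theta>. is_arg_max (\<lambda>(\<mu>, \<sigma>). folded_normal_loglik n y \<mu> \<sigma>) (\<lambda>\<theta>. \<theta> \<in> param_space) \<theta>"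
    using assms by (rule exists_folded_normal_mle)
  show "\<exists>!\<mu>. is_arg_max (\<lambda>\<mu>. folded_normal_loglik n y \<mu> \<sigma>) (\<lambda>\<mu>. \<mu> \<in> {0..}) \<mu>" if "\<sigma> > 0" for \<sigma>
    using assms that by (rule ex1_folded_normal_mu_mle)
  fix \<mu> \<sigma>
  assume "is_arg_max (\<lambda>(\<mu>, \<sigma>). folded_normal_loglik n y \<mu> \<sigma>) (\<lambda>\<theta>. \<theta> \<in> param_space) (\<mu>, \<sigma>)"
  then have \<sigma>: "\<sigma> > 0"
    and max: "\<And>\<mu>' \<sigma>'. \<sigma>' > 0 \<Longrightarrow> folded_normal_loglik n y \<mu>' \<sigma>' \<le> folded_normal_loglik n y \<mu> \<sigma>"
    by (auto simp: is_arg_max_linorder param_space_def)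
  \<comment> \<open>By evenness \<open>\<bar>\<mu>\<bar>\<close> attains the same value as
    \<open>\<mu>\<close>; uniqueness then identifies it with
    \<open>mu_hat n y \<sigma>\<close>.\<close>
  have "is_arg_max (\<lambda>\<mu>. folded_normal_loglik n y \<mu> \<sigma>) (\<lambda>\<mu>. \<mu> \<in> {0..}) \<bar>\<mu>\<bar>"
    using max[OF \<sigma>] by (auto simp: is_arg_max_linorder folded_normal_loglik_abs)
  then have mu_hat: "mu_hat n y \<sigma> = \<bar>\<mu>\<bar>"
    unfolding mu_hat_def using ex1_folded_normal_mu_mle[OF assms \<sigma>] by (intro the1_equality)
  then show "\<mu> = mu_hat n y \<sigma> \<or> \<mu> = - mu_hat n y \<sigma>" by auto
  \<comment> \<open>Every profile value is a value of the log-likelihood, and at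
    \<open>\<sigma>\<close> the profile equals the global maximum.\<close>
  show "is_arg_max (profile_loglik n y) (\<lambda>\<sigma>. \<sigma> \<in> {0<..}) \<sigma>"
    using max \<sigma> by (auto simp: is_arg_max_linorder profile_loglik_def mu_hat folded_normal_loglik_abs)
qed

end
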